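(* For every GP 2 program $P$ and all assertions $c,d$: if the triple $\{c\}\,P\,\{d\}$ is provable in the proof calculus $\mathsf{SEM}$, then $\{c\}\,P\,\{d\}$ is partially correct, i.e. for every host graph $G$ with $G\models c$ and every host graph $H\in[\![P]\!]G$, $H\models d$.
   Context: GP 2 host graphs have finite node/edge sets, source/target maps, node/edge labels (a list of integers and strings together with a mark) and rooted/unrooted nodes. A conditional rule schema $r$ defines a relation $G\Rightarrow_r H$ on host graphs (rule application via an injective match, label assignment, rule condition, dangling condition and natural double pushout). Programs are built from rule set calls $\mathcal{R}=\{r_1,\dots,r_n\}$, $\mathtt{break}$, $\mathtt{skip}$, $\mathtt{fail}$, $P;Q$, $P\ \mathtt{or}\ Q$, $\mathtt{if}\ C\ \mathtt{then}\ P\ \mathtt{else}\ Q$, $\mathtt{try}\ C\ \mathtt{then}\ P\ \mathtt{else}\ Q$, $P!$. Execution is given by a small-step relation $\to$ on configurations $\langle P,G\rangle$, host graphs and $\mathrm{fail}$; $[\![P]\!]G$ is the set of host graphs and $\mathrm{fail}$ reachable from $\langle P,G\rangle$ by $\to^+$, plus $\bot$ if $P$ can diverge or get stuck. Key facts: a rule set call yields every $H$ with $G\Rightarrow_r H$, $r\in\mathcal{R}$, or $\mathrm{fail}$ if none exists; $\mathtt{if}\ C\ \mathtt{then}\ P\ \mathtt{else}\ Q$ continues with $\langle P,G\rangle$ if $\langle C,G\rangle\to^+H$ for some graph $H$ and with $\langle Q,G\rangle$ if $\langle C,G\rangle\to^+\mathrm{fail}$; $\mathtt{try}$ is the same except that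 it continues with $\langle P,H\rangle$; $\langle P!,G\rangle\to\langle P!,H\rangle$ if $\langle P,G\rangle\to^+H$, $\langle P!,G\rangle\to G$ if $\langle P,G\rangle\to^+\mathrm{fail}$, and $\langle P!,G\rangle\to H$ if $\langle P,G\rangle\to^*\langle\mathtt{break},H\rangle$. Outside loops $\mathtt{break}$ is treated as $\mathtt{skip}$. Assertions are arbitrary properties of host graphs; $G\models c$ means $G$ has property $c$; $\wedge,\vee$ and "implies" are understood semantically. For a program $P$: $G\models\mathrm{SUCCESS}(P)$ iff some host graph $H\in[\![P]\!]G$; $G\models\mathrm{FAIL}(P)$ iff $\mathrm{fail}\in[\![P]\!]G$. $\mathrm{SLP}(c,r)$ is a strongest liberal postcondition: it holds of $H$ whenever $G\models c$ and $G\Rightarrow_r H$, and implies every assertion with this property. $\mathrm{WLP}(r,d)$ is a weakest liberal precondition: $G\models c$, $G\Rightarrow_r H$ imply $H\models d$ for $c=\mathrm{WLP}(r,d)$, and it is implied by every $c$ with this property. $\mathrm{Break}(c,P,d)$ holds iff for all derivations $\langle P,G\rangle\to^*\langle\mathtt{break},H\rangle$, $G\models c$ implies $H\models d$. The calculus $\mathsf{SEM}$ consists of: [ruleapp]$_{\mathrm{slp}}$: $\{c\}\,r\,\{\mathrm{SLP}(c,r)\}$; [ruleapp]$_{\mathrm{wlp}}$: $\{\mathrm{WLP}(r,d)\}\,r\,\{d\}$; [ruleset]: from $\{c\}\,r\,\{d\}$ for each $r\in\mathcal{R}$ infer $\{c\}\,\mathcal{R}\,\{d\}$; [comp]: from $\{c\}\,P\,\{e\}$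 and $\{e\}\,Q\,\{d\}$ infer $\{c\}\,P;Q\,\{d\}$; [cons]: from "$c$ implies $c'$", $\{c'\}\,P\,\{d'\}$ and "$d'$ implies $d$" infer $\{c\}\,P\,\{d\}$; [if]: from $\{c\wedge\mathrm{SUCCESS}(C)\}\,P\,\{d\}$ and $\{c\wedge\mathrm{FAIL}(C)\}\,Q\,\{d\}$ infer $\{c\}\,\mathtt{if}\ C\ \mathtt{then}\ P\ \mathtt{else}\ Q\,\{d\}$; [try]: from $\{c\wedge\mathrm{SUCCESS}(C)\}\,C;P\,\{d\}$ and $\{c\wedge\mathrm{FAIL}(C)\}\,Q\,\{d\}$ infer $\{c\}\,\mathtt{try}\ C\ \mathtt{then}\ P\ \mathtt{else}\ Q\,\{d\}$; [alap]: from $\{c\}\,P\,\{c\}$ and $\mathrm{Break}(c,P,d)$ infer $\{c\}\,P!\,\{(c\wedge\mathrm{FAIL}(P))\vee d\}$. A triple is provable if it is the root of a finite proof tree built from these axioms and rules. *)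

theory Defs
  imports "HOL-Library.FSet" "HOL-Library.Monad_Syntax"
begin

section \<open>Graphs, morphisms and natural pushouts\<close>

text \<open>
  Partially labelled graphs: node labels and rootedness may be undefined, as needed for the
  interface and the intermediate graph of a rule application. The maps are undefined outside the
  carriers, so that equality of records is equality of graphs. Every finite graph has a copy with
  identifiers in \<^typ>\<open>nat\<close>; hence the universal properties below, which quantify over graphs of
  this type, are those of the category of all finite graphs.
\<close>

record 'l graph =
  nodes :: "nat set"
  edges :: "nat set"
  src :: "nat \<rightharpoonup> nat"
  tgt :: "nat \<rightharpoonup> nat"
  nlab :: "nat \<rightharpoonup> 'l"
  elab :: "nat \<rightharpoonup> 'l"
  rooted :: "nat \<rightharpoonup> bool"

definition is_graph :: "'l graph \<Rightarrow> bool" where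
  "is_graph G \<longleftrightarrow>
     finite (nodes G) \<and> finite (edges G) \<and>
     dom (src G) = edges G \<and> ran (src G) \<subseteq> nodes G \<and>
     dom (tgt G) = edges G \<and> ran (tgt G) \<subseteq> nodes G \<and>
     dom (nlab G) \<subseteq> nodes G \<and> dom (elab G) = edges G \<and>
     dom (rooted G) \<subseteq> nodes G"

definition is_total_graph :: "'l graph \<Rightarrow> bool" where
  "is_total_graph G \<longleftrightarrow>
     is_graph G \<and> dom (nlab G) = nodes G \<and> dom (rooted G) = nodes G"

type_synonym morph = "(nat \<Rightarrow> nat) \<times> (nat \<Rightarrow> nat)"

definition is_morph :: "morph \<Rightarrow> 'l graph \<Rightarrow> 'l graph \<Rightarrow> bool" where
  "is_morph f G H \<longleftrightarrow>
     fst f ` nodes G \<subseteq> nodes H \<and> snd f ` edges G \<subseteq> edges H \<and>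
     (\<forall>e\<in>edges G. src H (snd f e) = map_option (fst f) (src G e) \<and>
                   tgt H (snd f e) = map_option (fst f) (tgt G e) \<and>
                   elab H (snd f e) = elab G e) \<and>
     (\<forall>v\<in>dom (nlab G). nlab H (fst f v) = nlab G v) \<and>
     (\<forall>v\<in>dom (rooted G). rooted H (fst f v) = rooted G v)"

definition inj_morph :: "morph \<Rightarrow> 'l graph \<Rightarrow> bool" where
  "inj_morph f G \<longleftrightarrow> inj_on (fst f) (nodes G) \<and> inj_on (snd f) (edges G)"

definition morph_comp :: "morph \<Rightarrow> morph \<Rightarrow> morph" (infixl "\<odot>" 55) where
  "g \<odot> f = (fst g \<circ> fst f, snd g \<circ> snd f)"

definition morph_eq :: "'l graph \<Rightarrow> morph \<Rightarrow> morph \<Rightarrow> bool" where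
  "morph_eq G f g \<longleftrightarrow>
     (\<forall>v\<in>nodes G. fst f v = fst g v) \<and> (\<forall>e\<in>edges G. snd f e = snd g e)"

definition inclusion :: morph where
  "inclusion = (id, id)"

definition is_square ::
  "'l graph \<Rightarrow> 'l graph \<Rightarrow> 'l graph \<Rightarrow> 'l graph \<Rightarrow> morph \<Rightarrow> morph \<Rightarrow> morph \<Rightarrow> morph \<Rightarrow> bool" where
  "is_square K A D G a b f g \<longleftrightarrow>
     is_graph K \<and> is_graph A \<and> is_graph D \<and> is_graph G \<and>
     is_morph a K A \<and> is_morph b K D \<and> is_morph f A G \<and> is_morph g D G \<and>
     morph_eq K (f \<odot> a) (g \<odot> b)"

definition is_pushout ::
  "'l graph \<Rightarrow> 'l graph \<Rightarrow> 'l graph \<Rightarrow> 'l graph \<Rightarrow> morph \<Rightarrow> morph \<Rightarrow> morph \<Rightarrow> morph \<Rightarrow> bool" where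
  "is_pushout K A D G a b f g \<longleftrightarrow>
     is_square K A D G a b f g \<and>
     (\<forall>X f' g'. is_square K A D X a b f' g' \<longrightarrow>
        (\<exists>u. is_morph u G X \<and> morph_eq A (u \<odot> f) f' \<and> morph_eq D (u \<odot> g) g' \<and>
             (\<forall>u'. is_morph u' G X \<and> morph_eq A (u' \<odot> f) f' \<and> morph_eq D (u' \<odot> g) g'
                   \<longrightarrow> morph_eq G u' u)))"

definition is_pullback ::
  "'l graph \<Rightarrow> 'l graph \<Rightarrow> 'l graph \<Rightarrow> 'l graph \<Rightarrow> morph \<Rightarrow> morph \<Rightarrow> morph \<Rightarrow> morph \<Rightarrow> bool" where
  "is_pullback K A D G a b f g \<longleftrightarrow>
     is_square K A D G a b f g \<and>
     (\<forall>X a' b'. is_square X A D G a' b' f g \<longrightarrow>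
        (\<exists>u. is_morph u X K \<and> morph_eq X (a \<odot> u) a' \<and> morph_eq X (b \<odot> u) b' \<and>
             (\<forall>u'. is_morph u' X K \<and> morph_eq X (a \<odot> u') a' \<and> morph_eq X (b \<odot> u') b'
                   \<longrightarrow> morph_eq X u' u)))"

definition natural_pushout ::
  "'l graph \<Rightarrow> 'l graph \<Rightarrow> 'l graph \<Rightarrow> 'l graph \<Rightarrow> morph \<Rightarrow> morph \<Rightarrow> morph \<Rightarrow> morph \<Rightarrow> bool" where
  "natural_pushout K A D G a b f g \<longleftrightarrow>
     is_pushout K A D G a b f g \<and> is_pullback K A D G a b f g"


section \<open>Host graphs\<close>

datatype atom = IntAtom int | StrAtom string

datatype mark = NoMark | Red | Green | Blue | Grey | Dashed

type_synonym label = "atom list \<times> mark"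

definition is_host_graph :: "label graph \<Rightarrow> bool" where
  "is_host_graph G \<longleftrightarrow>
     is_total_graph G \<and> Dashed \<notin> snd ` ran (nlab G) \<and> Grey \<notin> snd ` ran (elab G)"

definition empty_graph :: "'l graph" where
  "empty_graph = \<lparr>nodes = {}, edges = {}, src = Map.empty, tgt = Map.empty,
                  nlab = Map.empty, elab = Map.empty, rooted = Map.empty\<rparr>"

typedef host_graph = "{G. is_host_graph G}"
  morphisms graph_of Host_Graph
proof
  show "empty_graph \<in> {G. is_host_graph G}"
    by (simp add: empty_graph_def is_host_graph_def is_total_graph_def is_graph_def)
qed


section \<open>Conditional rule schemata\<close>

datatype arith_op = Plus | Minus | Times | Divide

datatype int_exp =
    IConst nat
  | IVar string
  | Neg int_exp
  | Arith arith_op int_exp int_exp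
  | LengthL string
  | LengthA string
  | LengthS string
  | Indeg nat
  | Outdeg nat

datatype str_exp =
    SConst string
  | CVar string
  | SVar string
  | SConc str_exp str_exp

datatype list_exp =
    EmptyL
  | IntL int_exp
  | StrL str_exp
  | AVar string
  | LVar string
  | ConcL list_exp list_exp

datatype rule_mark = Mark mark | AnyMark

type_synonym rule_label = "list_exp \<times> rule_mark"

datatype atom_type = IntT | CharT | StringT | AtomT

datatype rel_op = Gt | Ge | Lt | Le

datatype condition =
    TrueC
  | TypeC atom_type list_exp
  | EqC list_exp list_exp
  | NeqC list_exp list_exp
  | RelC rel_op int_exp int_exp
  | EdgeC nat nat
  | EdgeLabC nat nat rule_label
  | NotC condition
  | AndC condition condition
  | OrC condition condition

datatype var = IV string | CV string | SV string | AV string | LV string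

fun int_vars :: "int_exp \<Rightarrow> var set" where
  "int_vars (IConst n) = {}"
| "int_vars (IVar x) = {IV x}"
| "int_vars (Neg e) = int_vars e"
| "int_vars (Arith opr e e') = int_vars e \<union> int_vars e'"
| "int_vars (LengthL x) = {LV x}"
| "int_vars (LengthA x) = {AV x}"
| "int_vars (LengthS x) = {SV x}"
| "int_vars (Indeg v) = {}"
| "int_vars (Outdeg v) = {}"

fun str_vars :: "str_exp \<Rightarrow> var set" where
  "str_vars (SConst s) = {}"
| "str_vars (CVar x) = {CV x}"
| "str_vars (SVar x) = {SV x}"
| "str_vars (SConc e e') = str_vars e \<union> str_vars e'"

fun list_vars :: "list_exp \<Rightarrow> var set" where
  "list_vars EmptyL = {}"
| "list_vars (IntL e) = int_vars e"
| "list_vars (StrL e) = str_vars e"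
| "list_vars (AVar x) = {AV x}"
| "list_vars (LVar x) = {LV x}"
| "list_vars (ConcL e e') = list_vars e \<union> list_vars e'"

fun cond_vars :: "condition \<Rightarrow> var set" where
  "cond_vars TrueC = {}"
| "cond_vars (TypeC t e) = list_vars e"
| "cond_vars (EqC e e') = list_vars e \<union> list_vars e'"
| "cond_vars (NeqC e e') = list_vars e \<union> list_vars e'"
| "cond_vars (RelC opr e e') = int_vars e \<union> int_vars e'"
| "cond_vars (EdgeC u v) = {}"
| "cond_vars (EdgeLabC u v l) = list_vars (fst l)"
| "cond_vars (NotC b) = cond_vars b"
| "cond_vars (AndC b b') = cond_vars b \<union> cond_vars b'"
| "cond_vars (OrC b b') = cond_vars b \<union> cond_vars b'"

fun int_nodes :: "int_exp \<Rightarrow> nat set" where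
  "int_nodes (Neg e) = int_nodes e"
| "int_nodes (Arith opr e e') = int_nodes e \<union> int_nodes e'"
| "int_nodes (Indeg v) = {v}"
| "int_nodes (Outdeg v) = {v}"
| "int_nodes _ = {}"

fun list_nodes :: "list_exp \<Rightarrow> nat set" where
  "list_nodes (IntL e) = int_nodes e"
| "list_nodes (ConcL e e') = list_nodes e \<union> list_nodes e'"
| "list_nodes _ = {}"

fun cond_nodes :: "condition \<Rightarrow> nat set" where
  "cond_nodes TrueC = {}"
| "cond_nodes (TypeC t e) = list_nodes e"
| "cond_nodes (EqC e e') = list_nodes e \<union> list_nodes e'"
| "cond_nodes (NeqC e e') = list_nodes e \<union> list_nodes e'"
| "cond_nodes (RelC opr e e') = int_nodes e \<union> int_nodes e'"
| "cond_nodes (EdgeC u v) = {u, v}"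
| "cond_nodes (EdgeLabC u v l) = {u, v} \<union> list_nodes (fst l)"
| "cond_nodes (NotC b) = cond_nodes b"
| "cond_nodes (AndC b b') = cond_nodes b \<union> cond_nodes b'"
| "cond_nodes (OrC b b') = cond_nodes b \<union> cond_nodes b'"

text \<open>
  Left-hand labels are simple: no operators except unary minus and concatenation, at most one
  occurrence of a list variable, and at most one string variable per string expression.
\<close>

fun simple_int :: "int_exp \<Rightarrow> bool" where
  "simple_int (IConst n) = True"
| "simple_int (IVar x) = True"
| "simple_int (Neg e) = simple_int e"
| "simple_int _ = False"

fun count_svars :: "str_exp \<Rightarrow> nat" where
  "count_svars (SVar x) = 1"
| "count_svars (SConc e e') = count_svars e + count_svars e'"
| "count_svars _ = 0"

fun count_lvars :: "list_exp \<Rightarrow> nat" where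
  "count_lvars (LVar x) = 1"
| "count_lvars (ConcL e e') = count_lvars e + count_lvars e'"
| "count_lvars _ = 0"

fun simple_atoms :: "list_exp \<Rightarrow> bool" where
  "simple_atoms (IntL e) = simple_int e"
| "simple_atoms (StrL e) = (count_svars e \<le> 1)"
| "simple_atoms (ConcL e e') = (simple_atoms e \<and> simple_atoms e')"
| "simple_atoms _ = True"

definition simple_list :: "list_exp \<Rightarrow> bool" where
  "simple_list e \<longleftrightarrow> simple_atoms e \<and> count_lvars e \<le> 1"

text \<open>
  The interface consists of nodes only, unlabelled and with undefined rootedness, so it is given
  by its node set.
\<close>

record raw_rule =
  lhs :: "rule_label graph"
  interface :: "nat set"
  rhs :: "rule_label graph"
  cond :: condition

definition is_rule_graph :: "rule_label graph \<Rightarrow> bool" where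
  "is_rule_graph A \<longleftrightarrow>
     is_total_graph A \<and> Mark Dashed \<notin> snd ` ran (nlab A) \<and> Mark Grey \<notin> snd ` ran (elab A)"

definition list_exps :: "rule_label graph \<Rightarrow> list_exp set" where
  "list_exps A = fst ` (ran (nlab A) \<union> ran (elab A))"

definition is_rule_schema :: "raw_rule \<Rightarrow> bool" where
  "is_rule_schema r \<longleftrightarrow>
     is_rule_graph (lhs r) \<and> is_rule_graph (rhs r) \<and>
     interface r \<subseteq> nodes (lhs r) \<inter> nodes (rhs r) \<and>
     (\<forall>e\<in>list_exps (lhs r). simple_list e) \<and>
     (\<forall>e\<in>list_exps (rhs r). list_vars e \<subseteq> (\<Union>e'\<in>list_exps (lhs r). list_vars e') \<and>
                            list_nodes e \<subseteq> nodes (lhs r)) \<and>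
     cond_vars (cond r) \<subseteq> (\<Union>e'\<in>list_exps (lhs r). list_vars e') \<and>
     cond_nodes (cond r) \<subseteq> nodes (lhs r) \<and>
     (\<forall>v e. nlab (rhs r) v = Some (e, AnyMark) \<longrightarrow>
        v \<in> interface r \<and> (\<exists>e'. nlab (lhs r) v = Some (e', AnyMark))) \<and>
     (\<forall>i e. elab (rhs r) i = Some (e, AnyMark) \<longrightarrow>
        (\<exists>e'. elab (lhs r) i = Some (e', AnyMark)))"

typedef rule_schema = "{r. is_rule_schema r}"
  morphisms raw_of Rule_Schema
proof
  show "\<lparr>lhs = empty_graph, interface = {}, rhs = empty_graph, cond = TrueC\<rparr>
          \<in> {r. is_rule_schema r}"
    by (simp add: is_rule_schema_def empty_graph_def is_rule_graph_def is_total_graph_def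
        is_graph_def list_exps_def)
qed


section \<open>Rule application\<close>

record assignment =
  int_val :: "string \<Rightarrow> int"
  char_val :: "string \<Rightarrow> char"
  str_val :: "string \<Rightarrow> string"
  atom_val :: "string \<Rightarrow> atom"
  list_val :: "string \<Rightarrow> atom list"

definition indegree :: "'l graph \<Rightarrow> nat \<Rightarrow> nat" where
  "indegree G v = card {e \<in> edges G. tgt G e = Some v}"

definition outdegree :: "'l graph \<Rightarrow> nat \<Rightarrow> nat" where
  "outdegree G v = card {e \<in> edges G. src G e = Some v}"

fun eval_op :: "arith_op \<Rightarrow> int \<Rightarrow> int \<Rightarrow> int option" where
  "eval_op Plus m n = Some (m + n)"
| "eval_op Minus m n = Some (m - n)"
| "eval_op Times m n = Some (m * n)"
| "eval_op Divide m n = (if n = 0 then None else Some (m div n))"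

text \<open>
  Evaluation under an assignment and a match into a host graph; the latter is needed for degrees.
  The value \<^const>\<open>None\<close> arises from division by zero only.
\<close>

fun eval_int :: "assignment \<Rightarrow> morph \<Rightarrow> label graph \<Rightarrow> int_exp \<Rightarrow> int option" where
  "eval_int \<alpha> g G (IConst n) = Some (int n)"
| "eval_int \<alpha> g G (IVar x) = Some (int_val \<alpha> x)"
| "eval_int \<alpha> g G (Neg e) = map_option uminus (eval_int \<alpha> g G e)"
| "eval_int \<alpha> g G (Arith opr e e') =
     do { m \<leftarrow> eval_int \<alpha> g G e; n \<leftarrow> eval_int \<alpha> g G e'; eval_op opr m n }"
| "eval_int \<alpha> g G (LengthL x) = Some (int (length (list_val \<alpha> x)))"
| "eval_int \<alpha> g G (LengthA x) = Some 1"
| "eval_int \<alpha> g G (LengthS x) = Some (int (length (str_val \<alpha> x)))"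
| "eval_int \<alpha> g G (Indeg v) = Some (int (indegree G (fst g v)))"
| "eval_int \<alpha> g G (Outdeg v) = Some (int (outdegree G (fst g v)))"

fun eval_str :: "assignment \<Rightarrow> str_exp \<Rightarrow> string" where
  "eval_str \<alpha> (SConst s) = s"
| "eval_str \<alpha> (CVar x) = [char_val \<alpha> x]"
| "eval_str \<alpha> (SVar x) = str_val \<alpha> x"
| "eval_str \<alpha> (SConc e e') = eval_str \<alpha> e @ eval_str \<alpha> e'"

fun eval_list :: "assignment \<Rightarrow> morph \<Rightarrow> label graph \<Rightarrow> list_exp \<Rightarrow> atom list option" where
  "eval_list \<alpha> g G EmptyL = Some []"
| "eval_list \<alpha> g G (IntL e) = map_option (\<lambda>n. [IntAtom n]) (eval_int \<alpha> g G e)"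
| "eval_list \<alpha> g G (StrL e) = Some [StrAtom (eval_str \<alpha> e)]"
| "eval_list \<alpha> g G (AVar x) = Some [atom_val \<alpha> x]"
| "eval_list \<alpha> g G (LVar x) = Some (list_val \<alpha> x)"
| "eval_list \<alpha> g G (ConcL e e') =
     do { xs \<leftarrow> eval_list \<alpha> g G e; ys \<leftarrow> eval_list \<alpha> g G e'; Some (xs @ ys) }"

text \<open>The wildcard mark stands for every proper mark, that is, every mark except \<^const>\<open>NoMark\<close>.\<close>

fun mark_matches :: "rule_mark \<Rightarrow> mark \<Rightarrow> bool" where
  "mark_matches (Mark m) m' = (m = m')"
| "mark_matches AnyMark m' = (m' \<noteq> NoMark)"

fun has_type :: "atom_type \<Rightarrow> atom list \<Rightarrow> bool" where
  "has_type IntT xs = (\<exists>n. xs = [IntAtom n])"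
| "has_type CharT xs = (\<exists>c. xs = [StrAtom [c]])"
| "has_type StringT xs = (\<exists>s. xs = [StrAtom s])"
| "has_type AtomT xs = (\<exists>a. xs = [a])"

fun eval_rel :: "rel_op \<Rightarrow> int \<Rightarrow> int \<Rightarrow> bool" where
  "eval_rel Gt m n = (m > n)"
| "eval_rel Ge m n = (m \<ge> n)"
| "eval_rel Lt m n = (m < n)"
| "eval_rel Le m n = (m \<le> n)"

fun eval_cond :: "assignment \<Rightarrow> morph \<Rightarrow> label graph \<Rightarrow> condition \<Rightarrow> bool option" where
  "eval_cond \<alpha> g G TrueC = Some True"
| "eval_cond \<alpha> g G (TypeC t e) = map_option (has_type t) (eval_list \<alpha> g G e)"
| "eval_cond \<alpha> g G (EqC e e') =
     do { xs \<leftarrow> eval_list \<alpha> g G e; ys \<leftarrow> eval_list \<alpha> g G e'; Some (xs = ys) }"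
| "eval_cond \<alpha> g G (NeqC e e') =
     do { xs \<leftarrow> eval_list \<alpha> g G e; ys \<leftarrow> eval_list \<alpha> g G e'; Some (xs \<noteq> ys) }"
| "eval_cond \<alpha> g G (RelC opr e e') =
     do { m \<leftarrow> eval_int \<alpha> g G e; n \<leftarrow> eval_int \<alpha> g G e'; Some (eval_rel opr m n) }"
| "eval_cond \<alpha> g G (EdgeC u v) =
     Some (\<exists>i\<in>edges G. src G i = Some (fst g u) \<and> tgt G i = Some (fst g v))"
| "eval_cond \<alpha> g G (EdgeLabC u v l) =
     do { xs \<leftarrow> eval_list \<alpha> g G (fst l);
          Some (\<exists>i\<in>edges G. src G i = Some (fst g u) \<and> tgt G i = Some (fst g v) \<and>
                  (\<exists>m. elab G i = Some (xs, m) \<and> mark_matches (snd l) m)) }"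
| "eval_cond \<alpha> g G (NotC b) = map_option Not (eval_cond \<alpha> g G b)"
| "eval_cond \<alpha> g G (AndC b b') =
     do { p \<leftarrow> eval_cond \<alpha> g G b; q \<leftarrow> eval_cond \<alpha> g G b'; Some (p \<and> q) }"
| "eval_cond \<alpha> g G (OrC b b') =
     do { p \<leftarrow> eval_cond \<alpha> g G b; q \<leftarrow> eval_cond \<alpha> g G b'; Some (p \<or> q) }"

text \<open>
  A wildcard mark is instantiated by the mark of the matched host graph item. This applies to
  right-hand sides as well, where a wildcard requires a wildcard at the same item on the left.
\<close>

fun inst_label ::
  "assignment \<Rightarrow> morph \<Rightarrow> label graph \<Rightarrow> label option \<Rightarrow> rule_label \<Rightarrow> label option" where
  "inst_label \<alpha> g G hl (e, Mark m) = map_option (\<lambda>xs. (xs, m)) (eval_list \<alpha> g G e)"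
| "inst_label \<alpha> g G hl (e, AnyMark) =
     do { xs \<leftarrow> eval_list \<alpha> g G e; l \<leftarrow> hl;
          if mark_matches AnyMark (snd l) then Some (xs, snd l) else None }"

definition inst_graph ::
  "assignment \<Rightarrow> morph \<Rightarrow> label graph \<Rightarrow> rule_label graph \<Rightarrow> label graph" where
  "inst_graph \<alpha> g G A =
     \<lparr>nodes = nodes A, edges = edges A, src = src A, tgt = tgt A,
      nlab = (\<lambda>v. Option.bind (nlab A v) (inst_label \<alpha> g G (nlab G (fst g v)))),
      elab = (\<lambda>i. Option.bind (elab A i) (inst_label \<alpha> g G (elab G (snd g i)))),
      rooted = rooted A\<rparr>"

definition interface_graph :: "nat set \<Rightarrow> 'l graph" where
  "interface_graph V = empty_graph\<lparr>nodes := V\<rparr>"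

definition dangling_condition :: "raw_rule \<Rightarrow> morph \<Rightarrow> label graph \<Rightarrow> bool" where
  "dangling_condition r g G \<longleftrightarrow>
     (\<forall>i \<in> edges G - snd g ` edges (lhs r). \<forall>v \<in> nodes (lhs r) - interface r.
        src G i \<noteq> Some (fst g v) \<and> tgt G i \<noteq> Some (fst g v))"

text \<open>
  Host graph morphisms preserve labels and (defined) rootedness, so a match of the instantiated
  left-hand side maps rooted nodes to rooted nodes and unrooted nodes to unrooted nodes.
\<close>

definition rule_app :: "host_graph \<Rightarrow> rule_schema \<Rightarrow> host_graph \<Rightarrow> bool"
    ("_ \<Rightarrow>\<^bsub>_\<^esub> _" [51, 0, 51] 50) where
  "G \<Rightarrow>\<^bsub>r\<^esub> H \<longleftrightarrow>
     (\<exists>\<alpha> g D b d h d'.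
        let \<rho> = raw_of r; \<Gamma> = graph_of G; K = interface_graph (interface \<rho>);
            L = inst_graph \<alpha> g \<Gamma> (lhs \<rho>); R = inst_graph \<alpha> g \<Gamma> (rhs \<rho>)
        in is_host_graph L \<and> is_host_graph R \<and>
           is_morph g L \<Gamma> \<and> inj_morph g L \<and>
           eval_cond \<alpha> g \<Gamma> (cond \<rho>) = Some True \<and>
           dangling_condition \<rho> g \<Gamma> \<and>
           natural_pushout K L D \<Gamma> inclusion b g d \<and>
           natural_pushout K R D (graph_of H) inclusion b h d')"


section \<open>Programs and their operational semantics\<close>

datatype program =
    Call "rule_schema fset"
  | Break
  | Skip
  | Fail
  | Seq program program
  | Or program program
  | IfThenElse program program program
  | TryThenElse program program program
  | Loop program

datatype config = Conf program host_graph | Final host_graph | Failed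

lemma mono_tranclp [mono]:
  "(\<And>a b. x a b \<longrightarrow> y a b) \<Longrightarrow> x\<^sup>+\<^sup>+ a b \<longrightarrow> y\<^sup>+\<^sup>+ a b"
proof
  assume "\<And>a b. x a b \<longrightarrow> y a b" and "x\<^sup>+\<^sup>+ a b"
  from this(2,1) show "y\<^sup>+\<^sup>+ a b"
    by (induction rule: tranclp_induct) (auto intro: tranclp.intros)
qed

inductive step :: "config \<Rightarrow> config \<Rightarrow> bool" (infix "\<leadsto>" 50) where
  call1: "r |\<in>| \<R> \<Longrightarrow> G \<Rightarrow>\<^bsub>r\<^esub> H \<Longrightarrow> Conf (Call \<R>) G \<leadsto> Final H"
| call2: "(\<And>r H. r |\<in>| \<R> \<Longrightarrow> \<not> (G \<Rightarrow>\<^bsub>r\<^esub> H)) \<Longrightarrow> Conf (Call \<R>) G \<leadsto> Failed"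
| skip: "Conf Skip G \<leadsto> Final G"
| fail: "Conf Fail G \<leadsto> Failed"
| seq1: "Conf P G \<leadsto> Conf P' H \<Longrightarrow> Conf (Seq P Q) G \<leadsto> Conf (Seq P' Q) H"
| seq2: "Conf P G \<leadsto> Final H \<Longrightarrow> Conf (Seq P Q) G \<leadsto> Conf Q H"
| seq3: "Conf P G \<leadsto> Failed \<Longrightarrow> Conf (Seq P Q) G \<leadsto> Failed"
| break: "Conf (Seq Break P) G \<leadsto> Conf Break G"
| or1: "Conf (Or P Q) G \<leadsto> Conf P G"
| or2: "Conf (Or P Q) G \<leadsto> Conf Q G"
| if1: "step\<^sup>+\<^sup>+ (Conf C G) (Final H) \<Longrightarrow> Conf (IfThenElse C P Q) G \<leadsto> Conf P G"
| if2: "step\<^sup>+\<^sup>+ (Conf C G) Failed \<Longrightarrow> Conf (IfThenElse C P Q) G \<leadsto> Conf Q G"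
| try1: "step\<^sup>+\<^sup>+ (Conf C G) (Final H) \<Longrightarrow> Conf (TryThenElse C P Q) G \<leadsto> Conf P H"
| try2: "step\<^sup>+\<^sup>+ (Conf C G) Failed \<Longrightarrow> Conf (TryThenElse C P Q) G \<leadsto> Conf Q G"
| alap1: "step\<^sup>+\<^sup>+ (Conf P G) (Final H) \<Longrightarrow> Conf (Loop P) G \<leadsto> Conf (Loop P) H"
| alap2: "step\<^sup>+\<^sup>+ (Conf P G) Failed \<Longrightarrow> Conf (Loop P) G \<leadsto> Final G"
| alap3: "step\<^sup>*\<^sup>* (Conf P G) (Conf Break H) \<Longrightarrow> Conf (Loop P) G \<leadsto> Final H"

text \<open>
  Within a loop body \<^term>\<open>Conf Break G\<close> is a terminal configuration, on which the loop rules depend.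
  The convention that \<^const>\<open>Break\<close> acts as \<^const>\<open>Skip\<close> outside loops therefore cannot be a
  transition rule; it is applied to the program whose meaning is taken.
\<close>

fun skip_breaks :: "program \<Rightarrow> program" where
  "skip_breaks (Call \<R>) = Call \<R>"
| "skip_breaks Break = Skip"
| "skip_breaks Skip = Skip"
| "skip_breaks Fail = Fail"
| "skip_breaks (Seq P Q) = Seq (skip_breaks P) (skip_breaks Q)"
| "skip_breaks (Or P Q) = Or (skip_breaks P) (skip_breaks Q)"
| "skip_breaks (IfThenElse C P Q) = IfThenElse (skip_breaks C) (skip_breaks P) (skip_breaks Q)"
| "skip_breaks (TryThenElse C P Q) = TryThenElse (skip_breaks C) (skip_breaks P) (skip_breaks Q)"
| "skip_breaks (Loop P) = Loop P"

definition can_diverge :: "program \<Rightarrow> host_graph \<Rightarrow> bool" where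
  "can_diverge P G \<longleftrightarrow> (\<exists>\<sigma>::nat \<Rightarrow> config. \<sigma> 0 = Conf P G \<and> (\<forall>i. \<sigma> i \<leadsto> \<sigma> (Suc i)))"

definition can_get_stuck :: "program \<Rightarrow> host_graph \<Rightarrow> bool" where
  "can_get_stuck P G \<longleftrightarrow>
     (\<exists>Q H. step\<^sup>*\<^sup>* (Conf P G) (Conf Q H) \<and> (\<nexists>X. Conf Q H \<leadsto> X))"

datatype outcome = Graph host_graph | FailOutcome | Bottom

definition meaning :: "program \<Rightarrow> host_graph \<Rightarrow> outcome set" ("\<lbrakk>_\<rbrakk>") where
  "\<lbrakk>P\<rbrakk> G =
     {X. case X of
           Graph H \<Rightarrow> step\<^sup>+\<^sup>+ (Conf (skip_breaks P) G) (Final H)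
         | FailOutcome \<Rightarrow> step\<^sup>+\<^sup>+ (Conf (skip_breaks P) G) Failed
         | Bottom \<Rightarrow> can_diverge (skip_breaks P) G \<or> can_get_stuck (skip_breaks P) G}"


section \<open>Assertions and the calculus SEM\<close>

type_synonym assertion = "host_graph \<Rightarrow> bool"

definition implies :: "assertion \<Rightarrow> assertion \<Rightarrow> bool" where
  "implies c d \<longleftrightarrow> (\<forall>G. c G \<longrightarrow> d G)"

definition SUCCESS :: "program \<Rightarrow> assertion" where
  "SUCCESS P G \<longleftrightarrow> (\<exists>H. Graph H \<in> \<lbrakk>P\<rbrakk> G)"

definition FAIL :: "program \<Rightarrow> assertion" where
  "FAIL P G \<longleftrightarrow> FailOutcome \<in> \<lbrakk>P\<rbrakk> G"

definition liberal :: "assertion \<Rightarrow> rule_schema \<Rightarrow> assertion \<Rightarrow> bool" where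
  "liberal c r d \<longleftrightarrow> (\<forall>G H. c G \<and> G \<Rightarrow>\<^bsub>r\<^esub> H \<longrightarrow> d H)"

definition is_SLP :: "assertion \<Rightarrow> rule_schema \<Rightarrow> assertion \<Rightarrow> bool" where
  "is_SLP c r e \<longleftrightarrow> liberal c r e \<and> (\<forall>d. liberal c r d \<longrightarrow> implies e d)"

definition is_WLP :: "rule_schema \<Rightarrow> assertion \<Rightarrow> assertion \<Rightarrow> bool" where
  "is_WLP r d e \<longleftrightarrow> liberal e r d \<and> (\<forall>c. liberal c r d \<longrightarrow> implies c e)"

definition Break_pred :: "assertion \<Rightarrow> program \<Rightarrow> assertion \<Rightarrow> bool" where
  "Break_pred c P d \<longleftrightarrow> (\<forall>G H. step\<^sup>*\<^sup>* (Conf P G) (Conf Break H) \<longrightarrow> c G \<longrightarrow> d H)"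

inductive SEM_provable :: "assertion \<Rightarrow> program \<Rightarrow> assertion \<Rightarrow> bool" where
  ruleapp_slp: "is_SLP c r e \<Longrightarrow> SEM_provable c (Call {|r|}) e"
| ruleapp_wlp: "is_WLP r d e \<Longrightarrow> SEM_provable e (Call {|r|}) d"
| ruleset: "(\<And>r. r |\<in>| \<R> \<Longrightarrow> SEM_provable c (Call {|r|}) d) \<Longrightarrow> SEM_provable c (Call \<R>) d"
| comp: "SEM_provable c P e \<Longrightarrow> SEM_provable e Q d \<Longrightarrow> SEM_provable c (Seq P Q) d"
| cons: "implies c c' \<Longrightarrow> SEM_provable c' P d' \<Longrightarrow> implies d' d \<Longrightarrow> SEM_provable c P d"
| if_rule: "SEM_provable (\<lambda>G. c G \<and> SUCCESS C G) P d \<Longrightarrow>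
            SEM_provable (\<lambda>G. c G \<and> FAIL C G) Q d \<Longrightarrow>
            SEM_provable c (IfThenElse C P Q) d"
| try_rule: "SEM_provable (\<lambda>G. c G \<and> SUCCESS C G) (Seq C P) d \<Longrightarrow>
             SEM_provable (\<lambda>G. c G \<and> FAIL C G) Q d \<Longrightarrow>
             SEM_provable c (TryThenElse C P Q) d"
| alap: "SEM_provable c P c \<Longrightarrow> Break_pred c P d \<Longrightarrow>
         SEM_provable c (Loop P) (\<lambda>G. (c G \<and> FAIL P G) \<or> d G)"

definition partially_correct :: "assertion \<Rightarrow> program \<Rightarrow> assertion \<Rightarrow> bool" where
  "partially_correct c P d \<longleftrightarrow> (\<forall>G. c G \<longrightarrow> (\<forall>H. Graph H \<in> \<lbrakk>P\<rbrakk> G \<longrightarrow> d H))"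

end

theory Submission
  imports Defs
begin

text \<open>
  Soundness is shown by induction on the proof tree, with one subtlety. The meaning of a program is
  taken after its top-level breaks have been replaced by skips, whereas a loop executes its body
  with the breaks in place. The two agree where this matters: an execution that reaches a graph or
  failure never meets a break outside an inner loop, because such a break discards the rest of the
  program and leaves \<^const>\<open>Break\<close>, which has no successor. Hence replacing the breaks preserves
  the execution step by step, and an invariant of the body in the sense of
  \<^const>\<open>partially_correct\<close> is an invariant of the loop.
\<close>

lemma no_step_Final: "\<not> Final G \<leadsto> X"
  by (auto elim: step.cases)

lemma no_step_Failed: "\<not> Failed \<leadsto> X"
  by (auto elim: step.cases)

inductive_cases step_CallE: "Conf (Call \<R>) G \<leadsto> X"
inductive_cases step_BreakE: "Conf Break G \<leadsto> X"
inductive_cases step_SeqE: "Conf (Seq P Q) G \<leadsto> X"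
inductive_cases step_IfE: "Conf (IfThenElse C P Q) G \<leadsto> X"
inductive_cases step_TryE: "Conf (TryThenElse C P Q) G \<leadsto> X"
inductive_cases step_LoopE: "Conf (Loop P) G \<leadsto> X"

lemma steps_from_Final: "step\<^sup>*\<^sup>* (Final G) X \<longleftrightarrow> X = Final G"
  by (metis no_step_Final converse_rtranclpE rtranclp.rtrancl_refl)

lemma steps_from_Failed: "step\<^sup>*\<^sup>* Failed X \<longleftrightarrow> X = Failed"
  by (metis no_step_Failed converse_rtranclpE rtranclp.rtrancl_refl)

lemma steps_Conf_FinalE:
  assumes "step\<^sup>+\<^sup>+ (Conf P G) (Final H)"
  obtains "Conf P G \<leadsto> Final H"
  | P' G' where "Conf P G \<leadsto> Conf P' G'" "step\<^sup>+\<^sup>+ (Conf P' G') (Final H)"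
proof -
  from assms obtain X where X: "Conf P G \<leadsto> X" "step\<^sup>*\<^sup>* X (Final H)"
    by (blast dest: tranclpD)
  then show thesis
    using that by (cases X) (auto simp: steps_from_Final steps_from_Failed dest: rtranclpD)
qed

text \<open>The programs whose next command is a break. From here the original run drops the
  continuation, whereas the run with skips carries on with it, so exactly these targets must be
  exempted from the simulation.\<close>

inductive broken :: "program \<Rightarrow> bool" where
  "broken Break"
| "broken P \<Longrightarrow> broken (Seq P Q)"

text \<open>A broken program has no step to a graph or to failure, which excludes
  \<open>seq2\<close> and \<open>seq3\<close>; what remains is a step of the broken first component
  or the rule \<open>break\<close>.\<close>

lemma broken_step:
  "broken P \<Longrightarrow> Conf P G \<leadsto> X \<Longrightarrow> \<exists>P'. X = Conf P' G \<and> broken P'"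
proof (induction arbitrary: X rule: broken.induct)
  case 1
  then show ?case
    by (blast elim: step_BreakE)
next
  case (2 P Q)
  from "2.prems" show ?case
    by (cases rule: step_SeqE) (auto dest!: "2.IH" intro: broken.intros)
qed

lemma broken_steps:
  assumes "step\<^sup>*\<^sup>* (Conf P G) X" "broken P"
  shows "\<exists>P'. X = Conf P' G \<and> broken P'"
  using assms by (induction rule: rtranclp_induct) (auto dest: broken_step)

fun is_broken_config :: "config \<Rightarrow> bool" where
  "is_broken_config (Conf P G) = broken P"
| "is_broken_config _ = False"

fun skip_breaks_config :: "config \<Rightarrow> config" where
  "skip_breaks_config (Conf P G) = Conf (skip_breaks P) G"
| "skip_breaks_config X = X"

lemma is_broken_config_steps:
  "step\<^sup>*\<^sup>* X Y \<Longrightarrow> is_broken_config X \<Longrightarrow> is_broken_config Y"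
  by (cases X) (auto dest: broken_steps)

text \<open>The relation under the closure is the form in which \<open>step.induct\<close> delivers
  the premises of the rules for conditions and loops. Brokenness persists along steps, so an
  unbroken end forces every step before it to be simulated.\<close>

lemma skip_breaks_simulates_steps:
  assumes "(\<lambda>X Y. X \<leadsto> Y \<and>
             (is_broken_config Y \<or> skip_breaks_config X \<leadsto> skip_breaks_config Y))\<^sup>+\<^sup>+ X Y"
    and "\<not> is_broken_config Y"
  shows "step\<^sup>+\<^sup>+ (skip_breaks_config X) (skip_breaks_config Y)"
  using assms
proof (induction rule: tranclp_induct)
  case (base Y)
  then show ?case by auto
next
  case (step Y Z)
  then have "\<not> is_broken_config Y"
    using is_broken_config_steps by blast
  with step show ?case
    by (auto intro: tranclp.trancl_into_trancl)
qed

text \<open>Only \<open>break\<close>, and \<open>seq1\<close> around such a step, cannot be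
  matched, and their targets are broken. Runs of conditions end in a graph or failure, hence are
  matched throughout.\<close>

lemma skip_breaks_simulates_step:
  "X \<leadsto> Y \<Longrightarrow> is_broken_config Y \<or> skip_breaks_config X \<leadsto> skip_breaks_config Y"
proof (induction rule: step.induct)
  case (if1 C G H P Q)
  from skip_breaks_simulates_steps[OF if1] show ?case
    by (auto intro: step.if1)
next
  case (if2 C G P Q)
  from skip_breaks_simulates_steps[OF if2] show ?case
    by (auto intro: step.if2)
next
  case (try1 C G H P Q)
  from skip_breaks_simulates_steps[OF try1] show ?case
    by (auto intro: step.try1)
next
  case (try2 C G P Q)
  from skip_breaks_simulates_steps[OF try2] show ?case
    by (auto intro: step.try2)
next
  case (alap1 P G H)
  \<comment> \<open>\<open>skip_breaks\<close> leaves loops unchanged, so the original run of the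
    body is needed; it is recovered by forgetting the simulation conjunct.\<close>
  then have "step\<^sup>+\<^sup>+ (Conf P G) (Final H)"
    by (rule mono_tranclp[rule_format, rotated]) auto
  then show ?case
    by (auto intro: step.alap1)
next
  case (alap2 P G)
  then have "step\<^sup>+\<^sup>+ (Conf P G) Failed"
    by (rule mono_tranclp[rule_format, rotated]) auto
  then show ?case
    by (auto intro: step.alap2)
next
  case (alap3 P G H)
  then have "step\<^sup>*\<^sup>* (Conf P G) (Conf Break H)"
    by (rule rtranclp_mono[THEN predicate2D, rotated]) auto
  then show ?case
    by (auto intro: step.alap3)
qed (auto intro: step.intros broken.intros)

lemma skip_breaks_steps:
  assumes "step\<^sup>+\<^sup>+ X Y" "\<not> is_broken_config Y"
  shows "step\<^sup>+\<^sup>+ (skip_breaks_config X) (skip_breaks_config Y)"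
proof (rule skip_breaks_simulates_steps)
  show "(\<lambda>X Y. X \<leadsto> Y \<and>
          (is_broken_config Y \<or> skip_breaks_config X \<leadsto> skip_breaks_config Y))\<^sup>+\<^sup>+ X Y"
    using assms(1)
    by (rule mono_tranclp[rule_format, rotated]) (auto dest: skip_breaks_simulates_step)
qed (rule assms(2))

lemma Graph_in_meaning: "Graph H \<in> \<lbrakk>P\<rbrakk> G \<longleftrightarrow> step\<^sup>+\<^sup>+ (Conf (skip_breaks P) G) (Final H)"
  by (simp add: meaning_def)

text \<open>The converse fails: \<open>Seq Break Skip\<close> ends in \<open>Break\<close>, but its
  meaning contains a graph. This direction suffices to pass from the meaning of a loop body to the
  runs used by the loop.\<close>

lemma steps_Final_in_meaning: "step\<^sup>+\<^sup>+ (Conf P G) (Final H) \<Longrightarrow> Graph H \<in> \<lbrakk>P\<rbrakk> G"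
  by (drule skip_breaks_steps) (simp_all add: Graph_in_meaning)

lemma steps_Failed_imp_FAIL: "step\<^sup>+\<^sup>+ (Conf P G) Failed \<Longrightarrow> FAIL P G"
  by (drule skip_breaks_steps) (simp_all add: FAIL_def meaning_def)

lemma Seq_steps_FinalD:
  "step\<^sup>+\<^sup>+ (Conf (Seq P Q) G) (Final H) \<Longrightarrow>
     \<exists>M. step\<^sup>+\<^sup>+ (Conf P G) (Final M) \<and> step\<^sup>+\<^sup>+ (Conf Q M) (Final H)"
proof (induction "Conf (Seq P Q) G" arbitrary: P G rule: converse_tranclp_induct)
  case base
  then show ?case
    by (auto elim: step_SeqE)
next
  case (step X)
  from step.hyps(1) show ?case
  proof cases
    case (seq1 P' G')
    with step.hyps(3) show ?thesis
      by (blast intro: tranclp_into_tranclp2)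
  next
    case (seq2 M)
    with step.hyps(2) show ?thesis
      by blast
  next
    case seq3
    with step.hyps(2) show ?thesis
      using no_step_Failed by (blast dest: tranclpD)
  next
    case break
    with step.hyps(2) show ?thesis
      by (auto dest: tranclpD elim: step_BreakE)
  qed
qed

text \<open>Needed for \<open>try\<close>, whose premise speaks of \<open>Seq C P\<close> although
  the command runs \<open>C\<close> and then \<open>P\<close> separately.\<close>

lemma Seq_stepsI:
  assumes "step\<^sup>+\<^sup>+ (Conf P G) (Final M)" "step\<^sup>+\<^sup>+ (Conf Q M) (Final H)"
  shows "step\<^sup>+\<^sup>+ (Conf (Seq P Q) G) (Final H)"
  using assms(1)
proof (induction "Conf P G" arbitrary: P G rule: converse_tranclp_induct)
  case base
  then show ?case
    using assms(2) by (blast intro: seq2 tranclp_into_tranclp2)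
next
  case (step X)
  show ?case
  proof (cases X)
    case (Conf P' G')
    with step show ?thesis
      by (blast intro: seq1 tranclp_into_tranclp2)
  qed (use step.hyps(2) no_step_Final no_step_Failed in \<open>blast dest: tranclpD\<close>)+
qed

text \<open>Each iteration by \<open>alap1\<close> preserves \<open>c\<close>. The last step is
  either \<open>alap2\<close>, which returns the current graph after the body has failed on it, or
  \<open>alap3\<close>, where the break hypothesis gives \<open>d\<close>.\<close>

lemma Loop_steps_Final:
  assumes "step\<^sup>+\<^sup>+ (Conf (Loop P) G) (Final H)" "c G"
    and inv: "partially_correct c P c" and brk: "Break_pred c P d"
  shows "(c H \<and> FAIL P H) \<or> d H"
  using assms(1,2)
proof (induction "Conf (Loop P) G" arbitrary: G rule: converse_tranclp_induct)
  case base
  from base.hyps show ?case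
    by (rule step_LoopE) (use base.prems brk in \<open>auto simp: Break_pred_def steps_Failed_imp_FAIL\<close>)
next
  case (step X)
  from step.hyps(1) show ?case
  proof cases
    case (alap1 G')
    then have "c G'"
      using inv step.prems by (auto simp: partially_correct_def dest: steps_Final_in_meaning)
    with alap1 step.hyps(3) show ?thesis
      by blast
  qed (use step.hyps(2) no_step_Final in \<open>blast dest: tranclpD\<close>)+
qed

lemma Graph_in_meaning_Call:
  "Graph H \<in> \<lbrakk>Call \<R>\<rbrakk> G \<longleftrightarrow> (\<exists>r. r |\<in>| \<R> \<and> G \<Rightarrow>\<^bsub>r\<^esub> H)"
proof
  assume "Graph H \<in> \<lbrakk>Call \<R>\<rbrakk> G"
  then have "step\<^sup>+\<^sup>+ (Conf (Call \<R>) G) (Final H)"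
    by (simp add: Graph_in_meaning)
  then show "\<exists>r. r |\<in>| \<R> \<and> G \<Rightarrow>\<^bsub>r\<^esub> H"
    by (rule steps_Conf_FinalE) (auto elim: step_CallE)
qed (auto simp: Graph_in_meaning intro: call1)

theorem theorem4:
  fixes P :: program and c d :: assertion
  assumes "SEM_provable c P d"
  shows "partially_correct c P d"
  using assms
proof (induction rule: SEM_provable.induct)
  case (ruleapp_slp c r e)
  then show ?case
    by (auto simp: partially_correct_def Graph_in_meaning_Call is_SLP_def liberal_def)
next
  case (ruleapp_wlp r d e)
  then show ?case
    by (auto simp: partially_correct_def Graph_in_meaning_Call is_WLP_def liberal_def)
next
  case (ruleset \<R> c d)
  then show ?case
    by (auto simp: partially_correct_def Graph_in_meaning_Call)
next
  case (comp c P e Q d)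
  then show ?case
    by (auto simp: partially_correct_def Graph_in_meaning dest!: Seq_steps_FinalD)
next
  case (cons c c' P d' d)
  then show ?case
    by (auto simp: partially_correct_def implies_def)
next
  case (if_rule c C P d Q)
  show ?case
    unfolding partially_correct_def Graph_in_meaning skip_breaks.simps
  proof (intro allI impI)
    fix G H
    assume "c G"
    assume "step\<^sup>+\<^sup>+ (Conf (IfThenElse (skip_breaks C) (skip_breaks P) (skip_breaks Q)) G)
              (Final H)"
    then show "d H"
    proof (cases rule: steps_Conf_FinalE)
      case (2 P' G')
      \<comment> \<open>The run of the condition behind this step is itself the witness for
        \<open>SUCCESS C G\<close> or \<open>FAIL C G\<close>, since both are defined through
        \<open>skip_breaks C\<close>.\<close>
      from 2(1) show ?thesis
        by (rule step_IfE)
          (use 2(2) \<open>c G\<close> if_rule.IH in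
            \<open>auto simp: partially_correct_def SUCCESS_def FAIL_def meaning_def\<close>)
    qed (auto elim: step_IfE)
  qed
next
  case (try_rule c C P d Q)
  show ?case
    unfolding partially_correct_def Graph_in_meaning skip_breaks.simps
  proof (intro allI impI)
    fix G H
    assume "c G"
    assume "step\<^sup>+\<^sup>+ (Conf (TryThenElse (skip_breaks C) (skip_breaks P) (skip_breaks Q)) G)
              (Final H)"
    then show "d H"
    proof (cases rule: steps_Conf_FinalE)
      case (2 P' G')
      from 2(1) show ?thesis
        by (rule step_TryE)
          (use 2(2) \<open>c G\<close> try_rule.IH in
            \<open>auto simp: partially_correct_def SUCCESS_def FAIL_def meaning_def intro: Seq_stepsI\<close>)
    qed (auto elim: step_TryE)
  qed
next
  case (alap c P d)
  show ?case
    unfolding partially_correct_def Graph_in_meaning skip_breaks.simps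
    using Loop_steps_Final[OF _ _ alap.IH alap.hyps(2)] by simp
qed

end
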